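(* Let $X$ be a CLCH-space, $\mathcal{F}$ a sheaf of $\mathbb{C}$-vector spaces on $X$, $W\subset X$ a domain, and $(K,W)$ a Hartogs pair. Suppose there exist a CLCH-space $X'$, a sheaf $\mathcal{F}'$ of $\mathbb{C}$-vector spaces on $X'$ with $H^{1}(X',\mathcal{F}')=0$, and an open embedding $i\colon X\hookrightarrow X'$ such that $\mathcal{F}=i^{-1}\mathcal{F}'$. If $\mathcal{F}$ is Hartogs w.r.t. $(K,X)$, then $\mathcal{F}|_{W}$ is Hartogs w.r.t. $(K,W)$.
   Context: A CLCH-space is a connected locally compact Hausdorff topological space. A domain is a connected open subset. For a CLCH-space $X$ and a compact set $K\subset X$, $(K,X)$ is a Hartogs pair if $X\setminus K$ is connected. A sheaf $\mathcal{F}$ of $\mathbb{C}$-vector spaces on $X$ is Hartogs w.r.t. a Hartogs pair $(K,X)$ if the restriction $\Gamma(X,\mathcal{F})\to\Gamma(X\setminus K,\mathcal{F})$ is surjective. If $W\subset X$ is a domain and $(K,W)$ is a Hartogs pair, then $(K,X)$ is also a Hartogs pair. *)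

theory Defs
  imports "HOL-Analysis.Analysis" "HOL-Algebra.Module" "HOL-Algebra.AbelCoset"
begin

text \<open>The empty space counts as connected, following \<^const>\<open>connected_space\<close>.\<close>

definition clch_space :: "'a topology \<Rightarrow> bool" where
  "clch_space X \<longleftrightarrow> connected_space X \<and> locally_compact_space X \<and> Hausdorff_space X"

definition domain_in :: "'a topology \<Rightarrow> 'a set \<Rightarrow> bool" where
  "domain_in X W \<longleftrightarrow> openin X W \<and> connectedin X W"

definition hartogs_pair :: "'a set \<Rightarrow> 'a topology \<Rightarrow> bool" where
  "hartogs_pair K X \<longleftrightarrow>
     clch_space X \<and> compactin X K \<and> connectedin X (topspace X - K)"

definition open_embedding :: "'a topology \<Rightarrow> 'b topology \<Rightarrow> ('a \<Rightarrow> 'b) \<Rightarrow> bool" where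
  "open_embedding X Y i \<longleftrightarrow> embedding_map X Y i \<and> openin Y (i ` topspace X)"

text \<open>
  A complex vector space is a \<^locale>\<open>module\<close> over the following ring. The record type of
  modules extends the one of rings; its components \<open>mult\<close> and \<open>one\<close> play no role and are
  left undefined in the constructions below.
\<close>

definition complex_ring :: "complex ring" where
  "complex_ring = \<lparr>carrier = UNIV, mult = (*), one = 1, zero = 0, add = (+)\<rparr>"

type_synonym 's cvs = "(complex, 's) module"

definition linear_maps :: "'s cvs \<Rightarrow> 't cvs \<Rightarrow> ('s \<Rightarrow> 't) set" where
  "linear_maps M N = {f \<in> hom (add_monoid M) (add_monoid N).
     \<forall>c. \<forall>x\<in>carrier M. f (c \<odot>\<^bsub>M\<^esub> x) = c \<odot>\<^bsub>N\<^esub> f x}"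

definition quotient_module :: "'s cvs \<Rightarrow> 's set \<Rightarrow> 's set cvs" where
  "quotient_module M N =
     \<lparr>carrier = a_rcosets\<^bsub>M\<^esub> N, mult = undefined, one = undefined,
      zero = N, add = (\<lambda>A B. A <+>\<^bsub>M\<^esub> B),
      smult = (\<lambda>c A. \<Union>a\<in>A. N +>\<^bsub>M\<^esub> (c \<odot>\<^bsub>M\<^esub> a))\<rparr>"

definition product_module :: "'i set \<Rightarrow> ('i \<Rightarrow> 's cvs) \<Rightarrow> ('i \<Rightarrow> 's) cvs" where
  "product_module I M =
     \<lparr>carrier = (\<Pi>\<^sub>E i\<in>I. carrier (M i)), mult = undefined, one = undefined,
      zero = (\<lambda>i\<in>I. \<zero>\<^bsub>M i\<^esub>), add = (\<lambda>s t. \<lambda>i\<in>I. s i \<oplus>\<^bsub>M i\<^esub> t i),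
      smult = (\<lambda>c s. \<lambda>i\<in>I. c \<odot>\<^bsub>M i\<^esub> s i)\<rparr>"

record ('a, 's) presheaf_data =
  sections :: "'a set \<Rightarrow> 's cvs"
  res :: "'a set \<Rightarrow> 'a set \<Rightarrow> 's \<Rightarrow> 's"

locale presheaf =
  fixes X :: "'a topology" and F :: "('a, 's) presheaf_data"
  assumes sections_module: "openin X U \<Longrightarrow> module complex_ring (sections F U)"
    and res_linear: "\<lbrakk>openin X U; openin X V; V \<subseteq> U\<rbrakk>
      \<Longrightarrow> res F U V \<in> linear_maps (sections F U) (sections F V)"
    and res_id: "\<lbrakk>openin X U; s \<in> carrier (sections F U)\<rbrakk> \<Longrightarrow> res F U U s = s"
    and res_res: "\<lbrakk>openin X U; openin X V; openin X W; W \<subseteq> V; V \<subseteq> U;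
        s \<in> carrier (sections F U)\<rbrakk> \<Longrightarrow> res F V W (res F U V s) = res F U W s"

locale sheaf = presheaf +
  assumes locality: "\<lbrakk>\<And>V. V \<in> \<U> \<Longrightarrow> openin X V;
        s \<in> carrier (sections F (\<Union>\<U>)); t \<in> carrier (sections F (\<Union>\<U>));
        \<And>V. V \<in> \<U> \<Longrightarrow> res F (\<Union>\<U>) V s = res F (\<Union>\<U>) V t\<rbrakk> \<Longrightarrow> s = t"
    and gluing: "\<lbrakk>\<And>V. V \<in> \<U> \<Longrightarrow> openin X V;
        \<And>V. V \<in> \<U> \<Longrightarrow> \<sigma> V \<in> carrier (sections F V);
        \<And>V W. \<lbrakk>V \<in> \<U>; W \<in> \<U>\<rbrakk> \<Longrightarrow> res F V (V \<inter> W) (\<sigma> V) = res F W (V \<inter> W) (\<sigma> W)\<rbrakk>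
      \<Longrightarrow> \<exists>s\<in>carrier (sections F (\<Union>\<U>)). \<forall>V\<in>\<U>. res F (\<Union>\<U>) V s = \<sigma> V"

definition sheaf_isomorphic ::
    "'a topology \<Rightarrow> ('a, 's) presheaf_data \<Rightarrow> ('a, 't) presheaf_data \<Rightarrow> bool" where
  "sheaf_isomorphic X F G \<longleftrightarrow>
     (\<exists>\<phi>. (\<forall>U. openin X U \<longrightarrow> \<phi> U \<in> linear_maps (sections F U) (sections G U)
              \<and> bij_betw (\<phi> U) (carrier (sections F U)) (carrier (sections G U)))
        \<and> (\<forall>U V. openin X U \<and> openin X V \<and> V \<subseteq> U \<longrightarrow>
              (\<forall>s\<in>carrier (sections F U). \<phi> V (res F U V s) = res G U V (\<phi> U s))))"

text \<open>
  For \<open>W\<close> open, this is to be used as a sheaf on \<open>subtopology X W\<close>, whose open sets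
  satisfy \<open>W \<inter> U = U\<close>.
\<close>

definition restrict_sheaf :: "('a, 's) presheaf_data \<Rightarrow> 'a set \<Rightarrow> ('a, 's) presheaf_data" where
  "restrict_sheaf F W =
     \<lparr>sections = (\<lambda>U. sections F (W \<inter> U)), res = (\<lambda>U V. res F (W \<inter> U) (W \<inter> V))\<rparr>"

definition hartogs_sheaf :: "'a topology \<Rightarrow> ('a, 's) presheaf_data \<Rightarrow> 'a set \<Rightarrow> bool" where
  "hartogs_sheaf X F K \<longleftrightarrow>
     res F (topspace X) (topspace X - K) ` carrier (sections F (topspace X))
       = carrier (sections F (topspace X - K))"

type_synonym ('a, 's) germ = "('a set \<times> 's) set"

definition germ :: "'a topology \<Rightarrow> ('a, 's) presheaf_data \<Rightarrow> 'a \<Rightarrow> 'a set \<Rightarrow> 's \<Rightarrow> ('a, 's) germ" where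
  "germ X F x U s = {(V, t). openin X V \<and> x \<in> V \<and> t \<in> carrier (sections F V) \<and>
     (\<exists>W. openin X W \<and> x \<in> W \<and> W \<subseteq> U \<inter> V \<and> res F U W s = res F V W t)}"

definition stalk :: "'a topology \<Rightarrow> ('a, 's) presheaf_data \<Rightarrow> 'a \<Rightarrow> ('a, 's) germ cvs" where
  "stalk X F x =
     \<lparr>carrier = {germ X F x U s | U s. openin X U \<and> x \<in> U \<and> s \<in> carrier (sections F U)},
      mult = undefined, one = undefined,
      zero = germ X F x (topspace X) \<zero>\<^bsub>sections F (topspace X)\<^esub>,
      add = (\<lambda>g h. \<Union>(U, s)\<in>g. \<Union>(V, t)\<in>h. germ X F x (U \<inter> V)
         (res F U (U \<inter> V) s \<oplus>\<^bsub>sections F (U \<inter> V)\<^esub> res F V (U \<inter> V) t)),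
      smult = (\<lambda>c g. \<Union>(U, s)\<in>g. germ X F x U (c \<odot>\<^bsub>sections F U\<^esub> s))\<rparr>"

text \<open>
  The inverse image \<open>f\<inverse>G\<close> of a presheaf \<open>G\<close> on \<open>Y\<close> along a continuous map \<open>f\<close> from \<open>X\<close> to
  \<open>Y\<close>: a section over \<open>U\<close> assigns to each \<open>x \<in> U\<close> a germ of \<open>G\<close> at \<open>f x\<close>, and locally
  these germs come from one section of \<open>G\<close>. Equivalently, it is the sheaf associated to
  the presheaf sending \<open>U\<close> to the colimit of \<open>G(V)\<close> over the open sets \<open>V\<close> containing \<open>f ` U\<close>.
  For \<open>f\<close> the identity it is the sheaf associated to \<open>G\<close>.
\<close>

definition inverse_image ::
    "'a topology \<Rightarrow> ('a \<Rightarrow> 'b) \<Rightarrow> 'b topology \<Rightarrow> ('b, 's) presheaf_data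
      \<Rightarrow> ('a, 'a \<Rightarrow> ('b, 's) germ) presheaf_data" where
  "inverse_image X f Y G =
     \<lparr>sections = (\<lambda>U. (product_module U (\<lambda>x. stalk Y G (f x)))
        \<lparr>carrier := {s \<in> \<Pi>\<^sub>E x\<in>U. carrier (stalk Y G (f x)).
           \<forall>x\<in>U. \<exists>W V t. openin X W \<and> x \<in> W \<and> W \<subseteq> U \<and> openin Y V \<and> f ` W \<subseteq> V \<and>
             t \<in> carrier (sections G V) \<and> (\<forall>y\<in>W. s y = germ Y G (f y) V t)}\<rparr>),
      res = (\<lambda>U V s. restrict s V)\<rparr>"

definition sheafification ::
    "'a topology \<Rightarrow> ('a, 's) presheaf_data \<Rightarrow> ('a, 'a \<Rightarrow> ('a, 's) germ) presheaf_data" where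
  "sheafification X F = inverse_image X (\<lambda>x. x) X F"

definition cokernel_presheaf ::
    "('a, 's) presheaf_data \<Rightarrow> ('a, 't) presheaf_data \<Rightarrow> ('a set \<Rightarrow> 's \<Rightarrow> 't)
      \<Rightarrow> ('a, 't set) presheaf_data" where
  "cokernel_presheaf F G \<phi> =
     \<lparr>sections = (\<lambda>U. quotient_module (sections G U) (\<phi> U ` carrier (sections F U))),
      res = (\<lambda>U V A. \<Union>a\<in>A. (\<phi> V ` carrier (sections F V)) +>\<^bsub>sections G V\<^esub> res G U V a)\<rparr>"

text \<open>
  Cohomology is defined by Godement's canonical flasque resolution. Write \<open>C\<^sup>0(F)\<close> for the
  sheaf of all (possibly discontinuous) sections of the stalks of \<open>F\<close>, and
  \<open>Z(F) = C\<^sup>0(F)/F\<close> for the cokernel sheaf of the canonical map from \<open>F\<close> to \<open>C\<^sup>0(F)\<close>.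
  The resolution begins with \<open>C\<^sup>0(F)\<close>, \<open>C\<^sup>0(Z(F))\<close>, \<open>C\<^sup>0(Z(Z(F)))\<close>, and each
  differential is the composite of the maps from \<open>C\<^sup>0(G)\<close> to \<open>Z(G)\<close> and from \<open>Z(G)\<close> to
  \<open>C\<^sup>0(Z(G))\<close>, where \<open>G\<close> is \<open>F\<close> or \<open>Z(F)\<close>.
\<close>

definition godement ::
    "'a topology \<Rightarrow> ('a, 's) presheaf_data \<Rightarrow> ('a, 'a \<Rightarrow> ('a, 's) germ) presheaf_data" where
  "godement X F =
     \<lparr>sections = (\<lambda>U. product_module U (stalk X F)), res = (\<lambda>U V s. restrict s V)\<rparr>"

definition godement_unit ::
    "'a topology \<Rightarrow> ('a, 's) presheaf_data \<Rightarrow> 'a set \<Rightarrow> 's \<Rightarrow> 'a \<Rightarrow> ('a, 's) germ" where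
  "godement_unit X F U s = (\<lambda>x\<in>U. germ X F x U s)"

definition godement_coker_presheaf ::
    "'a topology \<Rightarrow> ('a, 's) presheaf_data
      \<Rightarrow> ('a, ('a \<Rightarrow> ('a, 's) germ) set) presheaf_data" where
  "godement_coker_presheaf X F = cokernel_presheaf F (godement X F) (godement_unit X F)"

definition godement_coker ::
    "'a topology \<Rightarrow> ('a, 's) presheaf_data
      \<Rightarrow> ('a, 'a \<Rightarrow> ('a, ('a \<Rightarrow> ('a, 's) germ) set) germ) presheaf_data" where
  "godement_coker X F = sheafification X (godement_coker_presheaf X F)"

definition godement_proj ::
    "'a topology \<Rightarrow> ('a, 's) presheaf_data \<Rightarrow> 'a set \<Rightarrow> ('a \<Rightarrow> ('a, 's) germ)
      \<Rightarrow> 'a \<Rightarrow> ('a, ('a \<Rightarrow> ('a, 's) germ) set) germ" where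
  "godement_proj X F U s =
     (\<lambda>x\<in>U. germ X (godement_coker_presheaf X F) x U
        ((godement_unit X F U ` carrier (sections F U)) +>\<^bsub>sections (godement X F) U\<^esub> s))"

definition godement_diff where
  "godement_diff X F U s = godement_unit X (godement_coker X F) U (godement_proj X F U s)"

definition sheaf_H1 where
  "sheaf_H1 X F =
    (let Z = godement_coker X F;
         C0 = sections (godement X F) (topspace X);
         C1 = sections (godement X Z) (topspace X);
         C2 = sections (godement X (godement_coker X Z)) (topspace X);
         cocycles = {s \<in> carrier C1. godement_diff X Z (topspace X) s = \<zero>\<^bsub>C2\<^esub>};
         coboundaries = godement_diff X F (topspace X) ` carrier C0
     in quotient_module (C1\<lparr>carrier := cocycles\<rparr>) coboundaries)"

definition zero_module :: "'s cvs \<Rightarrow> bool" where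
  "zero_module M \<longleftrightarrow> carrier M = {\<zero>\<^bsub>M\<^esub>}"

end

theory Submission
  imports Defs
begin

text \<open>Identify \<open>X\<close> with its image in \<open>X'\<close>. Since \<open>K\<close> is closed in \<open>X'\<close>, the sets \<open>X' - K\<close> and
  \<open>W\<close> form an open cover of \<open>X'\<close> with intersection \<open>W - K\<close>, and as \<open>H\<^sup>1\<close> vanishes, Mayer--Vietoris
  writes a section \<open>s\<close> over \<open>W - K\<close> as \<open>a - b\<close> with \<open>a\<close> defined over \<open>X' - K\<close> and \<open>b\<close> over \<open>W\<close>.
  The restriction of \<open>a\<close> to \<open>X - K\<close> extends to a section \<open>C\<close> over \<open>X\<close>, and \<open>C - b\<close> over \<open>W\<close>
  extends \<open>s\<close>. Scalar multiplication is irrelevant, so presheaves of abelian groups suffice.\<close>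

section \<open>Presheaves of abelian groups and their stalks\<close>

locale ab_presheaf =
  fixes X :: "'a topology" and F :: "('a, 's) presheaf_data"
  assumes sections_ab: "openin X U \<Longrightarrow> abelian_group (sections F U)"
    and res_closed: "\<lbrakk>openin X U; openin X V; V \<subseteq> U; s \<in> carrier (sections F U)\<rbrakk>
      \<Longrightarrow> res F U V s \<in> carrier (sections F V)"
    and res_add: "\<lbrakk>openin X U; openin X V; V \<subseteq> U;
        s \<in> carrier (sections F U); t \<in> carrier (sections F U)\<rbrakk>
      \<Longrightarrow> res F U V (s \<oplus>\<^bsub>sections F U\<^esub> t) = res F U V s \<oplus>\<^bsub>sections F V\<^esub> res F U V t"
    and res_id: "\<lbrakk>openin X U; s \<in> carrier (sections F U)\<rbrakk> \<Longrightarrow> res F U U s = s"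
    and res_res: "\<lbrakk>openin X U; openin X V; openin X W; W \<subseteq> V; V \<subseteq> U;
        s \<in> carrier (sections F U)\<rbrakk> \<Longrightarrow> res F V W (res F U V s) = res F U W s"

lemma linear_maps_closed:
  "\<lbrakk>f \<in> linear_maps M N; x \<in> carrier M\<rbrakk> \<Longrightarrow> f x \<in> carrier N"
  by (auto simp: linear_maps_def hom_def)

lemma linear_maps_add:
  "\<lbrakk>f \<in> linear_maps M N; x \<in> carrier M; y \<in> carrier M\<rbrakk>
    \<Longrightarrow> f (x \<oplus>\<^bsub>M\<^esub> y) = f x \<oplus>\<^bsub>N\<^esub> f y"
  by (auto simp: linear_maps_def hom_def)

sublocale presheaf \<subseteq> ab_presheaf X F
proof (rule ab_presheaf.intro)
  show "abelian_group (sections F U)" if "openin X U" for U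
    using sections_module[OF that] by (simp add: module_def)
  fix U V s assume *: "openin X U" "openin X V" "V \<subseteq> U" "s \<in> carrier (sections F U)"
  show "res F U V s \<in> carrier (sections F V)"
    by (rule linear_maps_closed[OF res_linear[OF *(1-3)] *(4)])
  show "res F U V (s \<oplus>\<^bsub>sections F U\<^esub> t) = res F U V s \<oplus>\<^bsub>sections F V\<^esub> res F U V t"
    if "t \<in> carrier (sections F U)" for t
    by (rule linear_maps_add[OF res_linear[OF *(1-3)] *(4) that])
qed (fact res_id res_res)+

lemma additive_zero:
  assumes "abelian_group M" "abelian_group N"
    and "\<And>x. x \<in> carrier M \<Longrightarrow> f x \<in> carrier N"
    and "\<And>x y. \<lbrakk>x \<in> carrier M; y \<in> carrier M\<rbrakk> \<Longrightarrow> f (x \<oplus>\<^bsub>M\<^esub> y) = f x \<oplus>\<^bsub>N\<^esub> f y"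
  shows "f \<zero>\<^bsub>M\<^esub> = \<zero>\<^bsub>N\<^esub>"
proof -
  interpret M: abelian_group M by fact
  interpret N: abelian_group N by fact
  have "f \<zero>\<^bsub>M\<^esub> \<oplus>\<^bsub>N\<^esub> f \<zero>\<^bsub>M\<^esub> = f \<zero>\<^bsub>M\<^esub>"
    using assms(4)[of "\<zero>\<^bsub>M\<^esub>" "\<zero>\<^bsub>M\<^esub>"] by simp
  then show ?thesis using assms(3)[of "\<zero>\<^bsub>M\<^esub>"] N.add.l_cancel_one by blast
qed

lemma additive_subgroup_image:
  assumes "abelian_group M" "abelian_group N"
    and "\<And>x. x \<in> carrier M \<Longrightarrow> f x \<in> carrier N"
    and "\<And>x y. \<lbrakk>x \<in> carrier M; y \<in> carrier M\<rbrakk> \<Longrightarrow> f (x \<oplus>\<^bsub>M\<^esub> y) = f x \<oplus>\<^bsub>N\<^esub> f y"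
  shows "abelian_subgroup (f ` carrier M) N"
proof -
  interpret M: abelian_group M by fact
  interpret N: abelian_group N by fact
  interpret group_hom "add_monoid M" "add_monoid N" f
    by unfold_locales (auto simp: hom_def assms)
  show ?thesis
    using img_is_subgroup abelian_subgroupI2[OF N.a_comm_group] by simp
qed

context ab_presheaf
begin

lemma res_zero:
  "\<lbrakk>openin X U; openin X V; V \<subseteq> U\<rbrakk> \<Longrightarrow> res F U V \<zero>\<^bsub>sections F U\<^esub> = \<zero>\<^bsub>sections F V\<^esub>"
  by (intro additive_zero sections_ab res_closed res_add)

lemma res_eq_mono:
  assumes "openin X U" "openin X V" "openin X W" "openin X W'" "W' \<subseteq> W" "W \<subseteq> U" "W \<subseteq> V"
    and "s \<in> carrier (sections F U)" "t \<in> carrier (sections F V)"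
    and "res F U W s = res F V W t"
  shows "res F U W' s = res F V W' t"
  using assms res_res by metis

lemma germ_self:
  "\<lbrakk>openin X U; x \<in> U; s \<in> carrier (sections F U)\<rbrakk> \<Longrightarrow> (U, s) \<in> germ X F x U s"
  by (auto simp: germ_def)

lemma germ_subset:
  assumes "openin X U" "openin X V" "s \<in> carrier (sections F U)" "t \<in> carrier (sections F V)"
    and W: "openin X W" "x \<in> W" "W \<subseteq> U" "W \<subseteq> V" "res F U W s = res F V W t"
  shows "germ X F x U s \<subseteq> germ X F x V t"
proof clarify
  fix V' t' assume "(V', t') \<in> germ X F x U s"
  then obtain W1 where V': "openin X V'" "x \<in> V'" "t' \<in> carrier (sections F V')"
    and W1: "openin X W1" "x \<in> W1" "W1 \<subseteq> U" "W1 \<subseteq> V'" "res F U W1 s = res F V' W1 t'"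
    by (auto simp: germ_def)
  have "res F V (W \<inter> W1) t = res F U (W \<inter> W1) s"
    by (rule sym, rule res_eq_mono[of _ _ W]) (use assms W W1 in auto)
  also have "\<dots> = res F V' (W \<inter> W1) t'"
    by (rule res_eq_mono[of _ _ W1]) (use assms W W1 V' in auto)
  finally show "(V', t') \<in> germ X F x V t"
    using V' W W1 by (auto simp: germ_def intro!: exI[of _ "W \<inter> W1"])
qed

lemma germ_eqI:
  assumes "openin X U" "openin X V" "s \<in> carrier (sections F U)" "t \<in> carrier (sections F V)"
    and "openin X W" "x \<in> W" "W \<subseteq> U" "W \<subseteq> V" "res F U W s = res F V W t"
  shows "germ X F x U s = germ X F x V t"
  using germ_subset[OF assms] germ_subset[OF assms(2,1,4,3,5,6,8,7) assms(9)[symmetric]] by blast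

lemma germ_eqE:
  assumes "germ X F x U s = germ X F x V t" "openin X V" "x \<in> V" "t \<in> carrier (sections F V)"
  obtains W where "openin X W" "x \<in> W" "W \<subseteq> U" "W \<subseteq> V" "res F U W s = res F V W t"
proof -
  have "(V, t) \<in> germ X F x U s" using assms germ_self by simp
  then show thesis using that by (auto simp: germ_def)
qed

lemma germ_res:
  assumes "openin X U" "openin X V" "x \<in> V" "V \<subseteq> U" "s \<in> carrier (sections F U)"
  shows "germ X F x V (res F U V s) = germ X F x U s"
  by (rule germ_eqI[where W = V]) (use assms in \<open>auto simp: res_closed res_id\<close>)

lemma germ_in_stalk:
  "\<lbrakk>openin X U; x \<in> U; s \<in> carrier (sections F U)\<rbrakk> \<Longrightarrow> germ X F x U s \<in> carrier (stalk X F x)"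
  by (auto simp: stalk_def)

lemma stalkE:
  assumes "g \<in> carrier (stalk X F x)"
  obtains U s where "openin X U" "x \<in> U" "s \<in> carrier (sections F U)" "g = germ X F x U s"
  using assms by (auto simp: stalk_def)

lemma germ_add_Int:
  assumes U: "openin X U" "x \<in> U" "s \<in> carrier (sections F U)"
    and V: "openin X V" "x \<in> V" "t \<in> carrier (sections F V)"
  shows "germ X F x U s \<oplus>\<^bsub>stalk X F x\<^esub> germ X F x V t =
    germ X F x (U \<inter> V) (res F U (U \<inter> V) s \<oplus>\<^bsub>sections F (U \<inter> V)\<^esub> res F V (U \<inter> V) t)"
    (is "_ = ?R")
proof -
  have const: "germ X F x (U' \<inter> V') (res F U' (U' \<inter> V') s'
      \<oplus>\<^bsub>sections F (U' \<inter> V')\<^esub> res F V' (U' \<inter> V') t') = ?R"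
    if "(U', s') \<in> germ X F x U s" "(V', t') \<in> germ X F x V t" for U' s' V' t'
  proof -
    from that(1) obtain W1 where U': "openin X U'" "x \<in> U'" "s' \<in> carrier (sections F U')"
      and W1: "openin X W1" "x \<in> W1" "W1 \<subseteq> U" "W1 \<subseteq> U'" "res F U W1 s = res F U' W1 s'"
      by (auto simp: germ_def)
    from that(2) obtain W2 where V': "openin X V'" "x \<in> V'" "t' \<in> carrier (sections F V')"
      and W2: "openin X W2" "x \<in> W2" "W2 \<subseteq> V" "W2 \<subseteq> V'" "res F V W2 t = res F V' W2 t'"
      by (auto simp: germ_def)
    let ?W = "W1 \<inter> W2"
    have o: "openin X (U \<inter> V)" "openin X (U' \<inter> V')" "openin X ?W"
      using U V U' V' W1 W2 by auto
    have 1: "res F U ?W s = res F U' ?W s'"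
      by (rule res_eq_mono[of _ _ W1]) (use U U' W1 W2 in auto)
    have 2: "res F V ?W t = res F V' ?W t'"
      by (rule res_eq_mono[of _ _ W2]) (use V V' W1 W2 in auto)
    have cl: "res F U (U \<inter> V) s \<in> carrier (sections F (U \<inter> V))"
      "res F V (U \<inter> V) t \<in> carrier (sections F (U \<inter> V))"
      "res F U' (U' \<inter> V') s' \<in> carrier (sections F (U' \<inter> V'))"
      "res F V' (U' \<inter> V') t' \<in> carrier (sections F (U' \<inter> V'))"
      using U V U' V' o by (auto intro!: res_closed)
    note add_closed = abelian_groupE(1)[OF sections_ab]
    show ?thesis
    proof (rule germ_eqI[where W = ?W])
      have *: "?W \<subseteq> U' \<inter> V'" "?W \<subseteq> U \<inter> V" using W1 W2 by auto
      have "res F (U' \<inter> V') ?W (res F U' (U' \<inter> V') s' \<oplus>\<^bsub>sections F (U' \<inter> V')\<^esub> res F V' (U' \<inter> V') t')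
        = res F U' ?W s' \<oplus>\<^bsub>sections F ?W\<^esub> res F V' ?W t'"
        using * o cl U' V' by (simp add: res_add res_res)
      moreover have "res F (U \<inter> V) ?W (res F U (U \<inter> V) s \<oplus>\<^bsub>sections F (U \<inter> V)\<^esub> res F V (U \<inter> V) t)
        = res F U ?W s \<oplus>\<^bsub>sections F ?W\<^esub> res F V ?W t"
        using * o cl U V by (simp add: res_add res_res)
      ultimately show "res F (U' \<inter> V') ?W
          (res F U' (U' \<inter> V') s' \<oplus>\<^bsub>sections F (U' \<inter> V')\<^esub> res F V' (U' \<inter> V') t')
        = res F (U \<inter> V) ?W (res F U (U \<inter> V) s \<oplus>\<^bsub>sections F (U \<inter> V)\<^esub> res F V (U \<inter> V) t)"
        using 1 2 by simp
    qed (use o cl W1 W2 in \<open>auto intro: add_closed\<close>)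
  qed
  have ne: "(U, s) \<in> germ X F x U s" "(V, t) \<in> germ X F x V t" using U V germ_self by auto
  have "(\<Union>(U', s')\<in>germ X F x U s. \<Union>(V', t')\<in>germ X F x V t.
      germ X F x (U' \<inter> V') (res F U' (U' \<inter> V') s'
        \<oplus>\<^bsub>sections F (U' \<inter> V')\<^esub> res F V' (U' \<inter> V') t')) = ?R" (is "?L = _")
  proof
    show "?L \<subseteq> ?R" using const by blast
    show "?R \<subseteq> ?L" using ne by blast
  qed
  then show ?thesis by (simp add: stalk_def)
qed

lemma germ_add:
  assumes "openin X U" "x \<in> U" "s \<in> carrier (sections F U)" "t \<in> carrier (sections F U)"
  shows "germ X F x U s \<oplus>\<^bsub>stalk X F x\<^esub> germ X F x U t = germ X F x U (s \<oplus>\<^bsub>sections F U\<^esub> t)"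
  using germ_add_Int[OF assms(1-3) assms(1,2,4)] assms by (simp add: res_id)

lemma germ_zero:
  assumes "openin X U" "x \<in> U"
  shows "germ X F x U \<zero>\<^bsub>sections F U\<^esub> = \<zero>\<^bsub>stalk X F x\<^esub>"
proof -
  have "germ X F x U (res F (topspace X) U \<zero>\<^bsub>sections F (topspace X)\<^esub>) =
      germ X F x (topspace X) \<zero>\<^bsub>sections F (topspace X)\<^esub>"
    using assms openin_subset by (intro germ_res abelian_groupE(2)[OF sections_ab]) auto
  then show ?thesis using assms by (simp add: res_zero stalk_def openin_subset)
qed

lemma stalkE2:
  assumes "g \<in> carrier (stalk X F x)" "h \<in> carrier (stalk X F x)"
  obtains U s t where "openin X U" "x \<in> U" "s \<in> carrier (sections F U)"
    "t \<in> carrier (sections F U)" "g = germ X F x U s" "h = germ X F x U t"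
proof -
  obtain U s where U: "openin X U" "x \<in> U" "s \<in> carrier (sections F U)" "g = germ X F x U s"
    using assms(1) stalkE by blast
  obtain V t where V: "openin X V" "x \<in> V" "t \<in> carrier (sections F V)" "h = germ X F x V t"
    using assms(2) stalkE by blast
  show thesis
  proof (rule that)
    show "openin X (U \<inter> V)" using U V by auto
    then show "g = germ X F x (U \<inter> V) (res F U (U \<inter> V) s)"
      "h = germ X F x (U \<inter> V) (res F V (U \<inter> V) t)"
      using U V by (auto simp: germ_res)
  qed (use U V in \<open>auto intro: res_closed\<close>)
qed

lemma stalk_ab:
  assumes "x \<in> topspace X"
  shows "abelian_group (stalk X F x)"
proof (rule abelian_groupI)
  fix g h assume gh: "g \<in> carrier (stalk X F x)" "h \<in> carrier (stalk X F x)"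
  then obtain U s t where U: "openin X U" "x \<in> U" "s \<in> carrier (sections F U)"
      "t \<in> carrier (sections F U)" "g = germ X F x U s" "h = germ X F x U t"
    by (rule stalkE2)
  interpret A: abelian_group "sections F U" using U sections_ab by blast
  show "g \<oplus>\<^bsub>stalk X F x\<^esub> h \<in> carrier (stalk X F x)"
    using U by (simp add: germ_add germ_in_stalk)
  show "g \<oplus>\<^bsub>stalk X F x\<^esub> h = h \<oplus>\<^bsub>stalk X F x\<^esub> g"
    using U by (simp add: germ_add A.a_comm)
  fix k assume "k \<in> carrier (stalk X F x)"
  then obtain V r where V: "openin X V" "x \<in> V" "r \<in> carrier (sections F V)" "k = germ X F x V r"
    using stalkE by blast
  let ?W = "U \<inter> V"
  interpret B: abelian_group "sections F ?W" using U V sections_ab by blast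
  have W: "openin X ?W" "x \<in> ?W" using U V by auto
  define s' t' r' where "s' = res F U ?W s" and "t' = res F U ?W t" and "r' = res F V ?W r"
  have cl: "s' \<in> carrier (sections F ?W)" "t' \<in> carrier (sections F ?W)"
      "r' \<in> carrier (sections F ?W)"
    using U V W by (auto simp: s'_def t'_def r'_def res_closed)
  have "g = germ X F x ?W s'" "h = germ X F x ?W t'" "k = germ X F x ?W r'"
    using U V W by (auto simp: s'_def t'_def r'_def germ_res)
  then show "g \<oplus>\<^bsub>stalk X F x\<^esub> h \<oplus>\<^bsub>stalk X F x\<^esub> k = g \<oplus>\<^bsub>stalk X F x\<^esub> (h \<oplus>\<^bsub>stalk X F x\<^esub> k)"
    using W cl by (simp add: germ_add B.a_assoc)
next
  interpret A: abelian_group "sections F (topspace X)" using sections_ab by blast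
  show "\<zero>\<^bsub>stalk X F x\<^esub> \<in> carrier (stalk X F x)"
    using germ_in_stalk[of "topspace X" x "\<zero>\<^bsub>sections F (topspace X)\<^esub>"] assms
    by (simp add: germ_zero)
next
  fix g assume "g \<in> carrier (stalk X F x)"
  then obtain U s where U: "openin X U" "x \<in> U" "s \<in> carrier (sections F U)" "g = germ X F x U s"
    using stalkE by blast
  interpret A: abelian_group "sections F U" using U sections_ab by blast
  show "\<zero>\<^bsub>stalk X F x\<^esub> \<oplus>\<^bsub>stalk X F x\<^esub> g = g"
    using U by (simp flip: germ_zero[of U] add: germ_add)
  show "\<exists>h\<in>carrier (stalk X F x). h \<oplus>\<^bsub>stalk X F x\<^esub> g = \<zero>\<^bsub>stalk X F x\<^esub>"
    by (rule bexI[of _ "germ X F x U (\<ominus>\<^bsub>sections F U\<^esub> s)"])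
      (use U in \<open>simp_all add: germ_add germ_zero germ_in_stalk A.l_neg\<close>)
qed

end

section \<open>Products, inverse images and cokernels\<close>

lemma product_module_sel [simp]:
  "carrier (product_module I M) = (\<Pi>\<^sub>E i\<in>I. carrier (M i))"
  "\<zero>\<^bsub>product_module I M\<^esub> = (\<lambda>i\<in>I. \<zero>\<^bsub>M i\<^esub>)"
  "s \<oplus>\<^bsub>product_module I M\<^esub> t = (\<lambda>i\<in>I. s i \<oplus>\<^bsub>M i\<^esub> t i)"
  by (simp_all add: product_module_def)

lemma abelian_group_function_module:
  assumes M: "\<And>i. i \<in> I \<Longrightarrow> abelian_group (M i)"
    and C: "C \<subseteq> (\<Pi>\<^sub>E i\<in>I. carrier (M i))"
    and zero: "(\<lambda>i\<in>I. \<zero>\<^bsub>M i\<^esub>) \<in> C"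
    and add: "\<And>s t. \<lbrakk>s \<in> C; t \<in> C\<rbrakk> \<Longrightarrow> (\<lambda>i\<in>I. s i \<oplus>\<^bsub>M i\<^esub> t i) \<in> C"
    and neg: "\<And>s. s \<in> C \<Longrightarrow> (\<lambda>i\<in>I. \<ominus>\<^bsub>M i\<^esub> s i) \<in> C"
  shows "abelian_group ((product_module I M)\<lparr>carrier := C\<rparr>)"
proof (rule abelian_groupI)
  fix s assume "s \<in> carrier (product_module I M\<lparr>carrier := C\<rparr>)"
  then have "s \<in> C" by simp
  then show "\<exists>t\<in>carrier (product_module I M\<lparr>carrier := C\<rparr>).
      t \<oplus>\<^bsub>product_module I M\<lparr>carrier := C\<rparr>\<^esub> s = \<zero>\<^bsub>product_module I M\<lparr>carrier := C\<rparr>\<^esub>"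
    using M C neg
    by (intro bexI[of _ "\<lambda>i\<in>I. \<ominus>\<^bsub>M i\<^esub> s i"])
      (auto simp: abelian_group.l_neg PiE_iff intro!: restrict_ext)
next
  fix s assume "s \<in> carrier (product_module I M\<lparr>carrier := C\<rparr>)"
  then have "s \<in> (\<Pi>\<^sub>E i\<in>I. carrier (M i))" using C by auto
  then show "\<zero>\<^bsub>product_module I M\<lparr>carrier := C\<rparr>\<^esub> \<oplus>\<^bsub>product_module I M\<lparr>carrier := C\<rparr>\<^esub> s = s"
    using abelian_groupE(5)[OF M] by (auto simp: PiE_iff fun_eq_iff extensional_def)
qed (use assms(4) zero C in \<open>auto simp: PiE_iff subset_iff
      intro!: restrict_ext abelian_groupE(3)[OF M] abelian_groupE(4)[OF M]\<close>)

lemma abelian_group_product_module: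
  assumes "\<And>i. i \<in> I \<Longrightarrow> abelian_group (M i)"
  shows "abelian_group (product_module I M)"
proof -
  have "abelian_group ((product_module I M)\<lparr>carrier := (\<Pi>\<^sub>E i\<in>I. carrier (M i))\<rparr>)"
    using assms
    by (intro abelian_group_function_module)
      (auto simp: PiE_iff intro: abelian_groupE(1,2) abelian_group.a_inv_closed)
  then show ?thesis by (simp add: product_module_def)
qed

lemma (in ab_presheaf) ab_presheaf_godement: "ab_presheaf X (godement X F)"
proof (rule ab_presheaf.intro)
  show "abelian_group (sections (godement X F) U)" if "openin X U" for U
    using that openin_subset
    by (auto simp: godement_def intro!: abelian_group_product_module stalk_ab)
  show "res (godement X F) U U s = s" if "s \<in> carrier (sections (godement X F) U)" for U s
    using that by (simp add: godement_def PiE_iff extensional_restrict)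
qed (auto simp: godement_def restrict_def fun_eq_iff subset_iff)

lemma inverse_image_carrier:
  "carrier (sections (inverse_image X f Y G) U) = {s \<in> \<Pi>\<^sub>E x\<in>U. carrier (stalk Y G (f x)).
     \<forall>x\<in>U. \<exists>W V t. openin X W \<and> x \<in> W \<and> W \<subseteq> U \<and> openin Y V \<and> f ` W \<subseteq> V \<and>
       t \<in> carrier (sections G V) \<and> (\<forall>y\<in>W. s y = germ Y G (f y) V t)}"
  by (simp add: inverse_image_def)

lemma inverse_image_sel [simp]:
  "\<zero>\<^bsub>sections (inverse_image X f Y G) U\<^esub> = (\<lambda>x\<in>U. \<zero>\<^bsub>stalk Y G (f x)\<^esub>)"
  "s \<oplus>\<^bsub>sections (inverse_image X f Y G) U\<^esub> t = (\<lambda>x\<in>U. s x \<oplus>\<^bsub>stalk Y G (f x)\<^esub> t x)"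
  "res (inverse_image X f Y G) U V s = restrict s V"
  by (simp_all add: inverse_image_def product_module_def)

context ab_presheaf
begin

lemma inverse_image_memI:
  assumes "f ` U \<subseteq> topspace X" "s \<in> extensional U"
    and loc: "\<And>x. x \<in> U \<Longrightarrow> \<exists>W V t. openin Z W \<and> x \<in> W \<and> W \<subseteq> U \<and> openin X V \<and> f ` W \<subseteq> V \<and>
       t \<in> carrier (sections F V) \<and> (\<forall>y\<in>W. s y = germ X F (f y) V t)"
  shows "s \<in> carrier (sections (inverse_image Z f X F) U)"
proof -
  have "s x \<in> carrier (stalk X F (f x))" if x: "x \<in> U" for x
  proof -
    from loc[OF x] obtain W V t where "x \<in> W" "openin X V" "f ` W \<subseteq> V"
       "t \<in> carrier (sections F V)" "\<forall>y\<in>W. s y = germ X F (f y) V t" by blast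
    then show ?thesis using germ_in_stalk[of V "f x" t] by auto
  qed
  then show ?thesis using assms by (simp add: inverse_image_carrier PiE_iff)
qed

lemma germ_a_inv:
  assumes "openin X U" "x \<in> U" "s \<in> carrier (sections F U)"
  shows "\<ominus>\<^bsub>stalk X F x\<^esub> germ X F x U s = germ X F x U (\<ominus>\<^bsub>sections F U\<^esub> s)"
proof -
  interpret A: abelian_group "sections F U" using assms sections_ab by blast
  interpret S: abelian_group "stalk X F x" using assms stalk_ab openin_subset by blast
  show ?thesis
    using assms by (intro S.minus_equality) (auto simp: germ_add germ_zero germ_in_stalk A.l_neg)
qed

lemma ab_presheaf_inverse_image:
  assumes f: "f ` topspace Z \<subseteq> topspace X"
  shows "ab_presheaf Z (inverse_image Z f X F)"
proof (rule ab_presheaf.intro)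
  fix U assume U: "openin Z U"
  note [simp] = inverse_image_carrier
  have fU: "f ` U \<subseteq> topspace X" using f U openin_subset by fast
  let ?C = "carrier (sections (inverse_image Z f X F) U)"
  have sec: "sections (inverse_image Z f X F) U =
      (product_module U (\<lambda>x. stalk X F (f x)))\<lparr>carrier := ?C\<rparr>"
    by (simp add: inverse_image_def)
  show "abelian_group (sections (inverse_image Z f X F) U)"
  proof (subst sec, rule abelian_group_function_module)
    show "abelian_group (stalk X F (f x))" if "x \<in> U" for x
      using that fU stalk_ab by blast
    show "?C \<subseteq> (\<Pi>\<^sub>E x\<in>U. carrier (stalk X F (f x)))" by auto
    show "(\<lambda>x\<in>U. \<zero>\<^bsub>stalk X F (f x)\<^esub>) \<in> ?C"
    proof (rule inverse_image_memI)
      fix x assume "x \<in> U"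
      then show "\<exists>W V t. openin Z W \<and> x \<in> W \<and> W \<subseteq> U \<and> openin X V \<and> f ` W \<subseteq> V \<and>
          t \<in> carrier (sections F V) \<and> (\<forall>y\<in>W. (\<lambda>x\<in>U. \<zero>\<^bsub>stalk X F (f x)\<^esub>) y = germ X F (f y) V t)"
        using U fU abelian_groupE(2)[OF sections_ab, of "topspace X"]
        by (intro exI[of _ U] exI[of _ "topspace X"] exI[of _ "\<zero>\<^bsub>sections F (topspace X)\<^esub>"])
          (auto simp: germ_zero)
    qed (use fU in auto)
    fix s assume s: "s \<in> ?C"
    show "(\<lambda>x\<in>U. \<ominus>\<^bsub>stalk X F (f x)\<^esub> s x) \<in> ?C"
    proof (rule inverse_image_memI)
      fix x assume "x \<in> U"
      then obtain W V t where "openin Z W" "x \<in> W" "W \<subseteq> U" "openin X V" "f ` W \<subseteq> V"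
          "t \<in> carrier (sections F V)" "\<forall>y\<in>W. s y = germ X F (f y) V t"
        using s by force
      then show "\<exists>W V t. openin Z W \<and> x \<in> W \<and> W \<subseteq> U \<and> openin X V \<and> f ` W \<subseteq> V \<and>
          t \<in> carrier (sections F V) \<and>
          (\<forall>y\<in>W. (\<lambda>x\<in>U. \<ominus>\<^bsub>stalk X F (f x)\<^esub> s x) y = germ X F (f y) V t)"
        by (intro exI[of _ W] exI[of _ V] exI[of _ "\<ominus>\<^bsub>sections F V\<^esub> t"])
          (auto simp: image_subset_iff germ_a_inv abelian_group.a_inv_closed[OF sections_ab])
    qed (use fU in auto)
    fix t assume t: "t \<in> ?C"
    show "(\<lambda>x\<in>U. s x \<oplus>\<^bsub>stalk X F (f x)\<^esub> t x) \<in> ?C"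
    proof (rule inverse_image_memI)
      fix x assume x: "x \<in> U"
      obtain W V a where a: "openin Z W" "x \<in> W" "W \<subseteq> U" "openin X V" "f ` W \<subseteq> V"
          "a \<in> carrier (sections F V)" "\<forall>y\<in>W. s y = germ X F (f y) V a"
        using s x by force
      obtain W' V' b where b: "openin Z W'" "x \<in> W'" "W' \<subseteq> U" "openin X V'" "f ` W' \<subseteq> V'"
          "b \<in> carrier (sections F V')" "\<forall>y\<in>W'. t y = germ X F (f y) V' b"
        using t x by force
      have cl: "res F V (V \<inter> V') a \<oplus>\<^bsub>sections F (V \<inter> V')\<^esub> res F V' (V \<inter> V') b
          \<in> carrier (sections F (V \<inter> V'))"
        using a b by (intro abelian_groupE(1)[OF sections_ab] res_closed) auto
      have "\<forall>y\<in>W \<inter> W'. (\<lambda>x\<in>U. s x \<oplus>\<^bsub>stalk X F (f x)\<^esub> t x) y = germ X F (f y) (V \<inter> V')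
          (res F V (V \<inter> V') a \<oplus>\<^bsub>sections F (V \<inter> V')\<^esub> res F V' (V \<inter> V') b)"
        using a b by (auto simp: image_subset_iff subset_iff germ_add_Int)
      moreover have "openin Z (W \<inter> W')" "x \<in> W \<inter> W'" "W \<inter> W' \<subseteq> U" "openin X (V \<inter> V')"
          "f ` (W \<inter> W') \<subseteq> V \<inter> V'"
        using a b by auto
      ultimately show "\<exists>W V r. openin Z W \<and> x \<in> W \<and> W \<subseteq> U \<and> openin X V \<and> f ` W \<subseteq> V \<and>
          r \<in> carrier (sections F V) \<and>
          (\<forall>y\<in>W. (\<lambda>x\<in>U. s x \<oplus>\<^bsub>stalk X F (f x)\<^esub> t x) y = germ X F (f y) V r)"
        using cl by blast
    qed (use fU in auto)
  qed
  fix V s assume V: "openin Z V" "V \<subseteq> U" and s: "s \<in> ?C"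
  show "res (inverse_image Z f X F) U V s \<in> carrier (sections (inverse_image Z f X F) V)"
    unfolding inverse_image_sel
  proof (rule inverse_image_memI)
    fix x assume x: "x \<in> V"
    then obtain W N t where W: "openin Z W" "x \<in> W" "W \<subseteq> U" "openin X N" "f ` W \<subseteq> N"
          "t \<in> carrier (sections F N)" "\<forall>y\<in>W. s y = germ X F (f y) N t"
        using s V by force
    then show "\<exists>W N t. openin Z W \<and> x \<in> W \<and> W \<subseteq> V \<and> openin X N \<and> f ` W \<subseteq> N \<and>
          t \<in> carrier (sections F N) \<and> (\<forall>y\<in>W. restrict s V y = germ X F (f y) N t)"
      using x V by (intro exI[of _ "W \<inter> V"] exI[of _ N] exI[of _ t]) auto
  qed (use V fU in auto)
next
  fix U s assume "s \<in> carrier (sections (inverse_image Z f X F) U)"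
  then have "s \<in> extensional U" by (simp add: inverse_image_carrier PiE_iff)
  then show "res (inverse_image Z f X F) U U s = s" by (simp add: extensional_restrict)
qed (simp_all add: restrict_def fun_eq_iff subset_iff)

end

lemma quotient_module_ab:
  assumes "abelian_subgroup N M"
  shows "abelian_group (quotient_module M N)"
proof -
  interpret abelian_subgroup N M by fact
  have "comm_group (M A_Mod N)" by (rule a_factorgroup_is_comm_group)
  note comm_groupE[OF this]
  then show ?thesis
    by (intro abelian_groupI)
      (auto simp: A_FactGroup_def FactGroup_def A_RCOSETS_def set_add_def quotient_module_def)
qed

locale ab_presheaf_hom = F: ab_presheaf X F + G: ab_presheaf X G
  for X :: "'a topology" and F :: "('a, 's) presheaf_data" and G :: "('a, 't) presheaf_data" +
  fixes \<phi> :: "'a set \<Rightarrow> 's \<Rightarrow> 't"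
  assumes hom_closed: "\<lbrakk>openin X U; s \<in> carrier (sections F U)\<rbrakk> \<Longrightarrow> \<phi> U s \<in> carrier (sections G U)"
    and hom_add: "\<lbrakk>openin X U; s \<in> carrier (sections F U); t \<in> carrier (sections F U)\<rbrakk>
      \<Longrightarrow> \<phi> U (s \<oplus>\<^bsub>sections F U\<^esub> t) = \<phi> U s \<oplus>\<^bsub>sections G U\<^esub> \<phi> U t"
    and hom_natural: "\<lbrakk>openin X U; openin X V; V \<subseteq> U; s \<in> carrier (sections F U)\<rbrakk>
      \<Longrightarrow> res G U V (\<phi> U s) = \<phi> V (res F U V s)"
begin

abbreviation img :: "'a set \<Rightarrow> 't set" where
  "img U \<equiv> \<phi> U ` carrier (sections F U)"

abbreviation coker :: "('a, 't set) presheaf_data" where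
  "coker \<equiv> cokernel_presheaf F G \<phi>"

lemma img_subgroup: "openin X U \<Longrightarrow> abelian_subgroup (img U) (sections G U)"
  by (rule additive_subgroup_image) (auto simp: F.sections_ab G.sections_ab hom_closed hom_add)

lemma coker_carrierI:
  assumes "openin X U" "a \<in> carrier (sections G U)"
  shows "img U +>\<^bsub>sections G U\<^esub> a \<in> carrier (sections coker U)"
proof -
  interpret abelian_subgroup "img U" "sections G U" using assms img_subgroup by blast
  show ?thesis
    using assms a_rcosetsI[OF a_subset]
    by (simp add: cokernel_presheaf_def quotient_module_def)
qed

lemma coker_carrierE:
  assumes "A \<in> carrier (sections coker U)"
  obtains a where "a \<in> carrier (sections G U)" "A = img U +>\<^bsub>sections G U\<^esub> a"
  using assms by (auto simp: cokernel_presheaf_def quotient_module_def A_RCOSETS_def')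

lemma coker_zero: "\<zero>\<^bsub>sections coker U\<^esub> = img U"
  by (simp add: cokernel_presheaf_def quotient_module_def)

lemma coker_add:
  assumes "openin X U" "a \<in> carrier (sections G U)" "b \<in> carrier (sections G U)"
  shows "(img U +>\<^bsub>sections G U\<^esub> a) \<oplus>\<^bsub>sections coker U\<^esub> (img U +>\<^bsub>sections G U\<^esub> b) =
    img U +>\<^bsub>sections G U\<^esub> (a \<oplus>\<^bsub>sections G U\<^esub> b)"
proof -
  interpret abelian_subgroup "img U" "sections G U" using assms img_subgroup by blast
  show ?thesis
    using assms a_rcos_sum by (simp add: cokernel_presheaf_def quotient_module_def)
qed

lemma coset_eq_iff:
  assumes "openin X U" "a \<in> carrier (sections G U)" "b \<in> carrier (sections G U)"
  shows "img U +>\<^bsub>sections G U\<^esub> a = img U +>\<^bsub>sections G U\<^esub> b \<longleftrightarrow>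
    (\<exists>r\<in>carrier (sections F U). a = \<phi> U r \<oplus>\<^bsub>sections G U\<^esub> b)"
proof -
  interpret abelian_subgroup "img U" "sections G U" using assms img_subgroup by blast
  have "img U +>\<^bsub>sections G U\<^esub> a = img U +>\<^bsub>sections G U\<^esub> b \<longleftrightarrow> a \<in> img U +>\<^bsub>sections G U\<^esub> b"
    using assms a_repr_independenceD[of a b] a_repr_independence'[of a b] by metis
  then show ?thesis by (auto simp: a_r_coset_def')
qed

lemma coker_res:
  assumes U: "openin X U" "openin X V" "V \<subseteq> U" and a: "a \<in> carrier (sections G U)"
  shows "res coker U V (img U +>\<^bsub>sections G U\<^esub> a) = img V +>\<^bsub>sections G V\<^esub> res G U V a"
proof -
  interpret abelian_subgroup "img U" "sections G U" using U img_subgroup by blast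
  have "img V +>\<^bsub>sections G V\<^esub> res G U V b = img V +>\<^bsub>sections G V\<^esub> res G U V a"
    if "b \<in> img U +>\<^bsub>sections G U\<^esub> a" for b
  proof -
    obtain r where r: "r \<in> carrier (sections F U)" "b = \<phi> U r \<oplus>\<^bsub>sections G U\<^esub> a"
      using \<open>b \<in> _\<close> by (auto simp: a_r_coset_def')
    then have "b \<in> carrier (sections G U)" using U a hom_closed by simp
    moreover have "res G U V b = \<phi> V (res F U V r) \<oplus>\<^bsub>sections G V\<^esub> res G U V a"
      using r U a by (simp add: G.res_add hom_closed hom_natural)
    ultimately have "\<exists>r\<in>carrier (sections F V). res G U V b = \<phi> V r \<oplus>\<^bsub>sections G V\<^esub> res G U V a"
      using F.res_closed U r by blast
    then show ?thesis
      using U a \<open>b \<in> carrier (sections G U)\<close> by (simp add: coset_eq_iff G.res_closed)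
  qed
  moreover have "img U +>\<^bsub>sections G U\<^esub> a \<noteq> {}" using a a_rcos_self by blast
  ultimately have "(\<Union>b\<in>img U +>\<^bsub>sections G U\<^esub> a. img V +>\<^bsub>sections G V\<^esub> res G U V b) =
      img V +>\<^bsub>sections G V\<^esub> res G U V a"
    by (intro SUP_eq_const)
  then show ?thesis by (simp add: cokernel_presheaf_def)
qed

lemma ab_presheaf_coker: "ab_presheaf X coker"
proof (rule ab_presheaf.intro)
  fix U assume U: "openin X U"
  show "abelian_group (sections coker U)"
    using quotient_module_ab img_subgroup[OF U] by (simp add: cokernel_presheaf_def)
  fix A assume "A \<in> carrier (sections coker U)"
  then obtain a where a: "a \<in> carrier (sections G U)" "A = img U +>\<^bsub>sections G U\<^esub> a"
    by (rule coker_carrierE)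
  show "res coker U U A = A" using a U by (simp add: coker_res G.res_id)
  fix V assume V: "openin X V" "V \<subseteq> U"
  show "res coker U V A \<in> carrier (sections coker V)"
    using a U V by (auto simp: coker_res G.res_closed intro!: coker_carrierI)
  show "res coker V W (res coker U V A) = res coker U W A" if "openin X W" "W \<subseteq> V" for W
    using that a U V by (simp add: coker_res G.res_res G.res_closed)
  fix B assume "B \<in> carrier (sections coker U)"
  then obtain b where b: "b \<in> carrier (sections G U)" "B = img U +>\<^bsub>sections G U\<^esub> b"
    by (rule coker_carrierE)
  show "res coker U V (A \<oplus>\<^bsub>sections coker U\<^esub> B) =
      res coker U V A \<oplus>\<^bsub>sections coker V\<^esub> res coker U V B"
    using a b U V abelian_groupE(1)[OF G.sections_ab, of U a b]
    by (simp add: coker_add coker_res G.res_add G.res_closed)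
qed

end

section \<open>The Godement sequence\<close>

lemma godement_sel [simp]:
  "carrier (sections (godement X F) U) = (\<Pi>\<^sub>E x\<in>U. carrier (stalk X F x))"
  "\<zero>\<^bsub>sections (godement X F) U\<^esub> = (\<lambda>x\<in>U. \<zero>\<^bsub>stalk X F x\<^esub>)"
  "s \<oplus>\<^bsub>sections (godement X F) U\<^esub> t = (\<lambda>x\<in>U. s x \<oplus>\<^bsub>stalk X F x\<^esub> t x)"
  "res (godement X F) U V s = restrict s V"
  by (simp_all add: godement_def)

lemma stalk_zero: "\<zero>\<^bsub>stalk X F x\<^esub> = germ X F x (topspace X) \<zero>\<^bsub>sections F (topspace X)\<^esub>"
  by (simp add: stalk_def)

context ab_presheaf
begin

lemma godement_unit_hom: "ab_presheaf_hom X F (godement X F) (godement_unit X F)"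
proof (intro ab_presheaf_hom.intro ab_presheaf_axioms ab_presheaf_godement
    ab_presheaf_hom_axioms.intro)
  show "res (godement X F) U V (godement_unit X F U s) = godement_unit X F V (res F U V s)"
    if "openin X U" "openin X V" "V \<subseteq> U" "s \<in> carrier (sections F U)" for U V s
    using that by (auto simp: godement_unit_def fun_eq_iff restrict_def germ_res)
qed (auto simp: godement_unit_def germ_in_stalk germ_add fun_eq_iff)

interpretation unit: ab_presheaf_hom X F "godement X F" "godement_unit X F"
  by (rule godement_unit_hom)

interpretation coker_pre: ab_presheaf X "godement_coker_presheaf X F"
  unfolding godement_coker_presheaf_def by (rule unit.ab_presheaf_coker)

lemma ab_presheaf_godement_coker: "ab_presheaf X (godement_coker X F)"
  unfolding godement_coker_def sheafification_def
  by (rule coker_pre.ab_presheaf_inverse_image) simp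

lemma godement_coker_memI:
  assumes U: "openin X U" "z \<in> extensional U"
    and loc: "\<And>x. x \<in> U \<Longrightarrow> \<exists>V t. openin X V \<and> x \<in> V \<and> V \<subseteq> U \<and>
       t \<in> carrier (sections (godement_coker_presheaf X F) V) \<and>
       (\<forall>y\<in>V. z y = germ X (godement_coker_presheaf X F) y V t)"
  shows "z \<in> carrier (sections (godement_coker X F) U)"
  unfolding godement_coker_def sheafification_def
proof (rule coker_pre.inverse_image_memI)
  show "(\<lambda>x. x) ` U \<subseteq> topspace X" using U openin_subset by auto
  fix x assume "x \<in> U"
  from loc[OF this] obtain V t where "openin X V \<and> x \<in> V \<and> V \<subseteq> U \<and>
       t \<in> carrier (sections (godement_coker_presheaf X F) V) \<and>
       (\<forall>y\<in>V. z y = germ X (godement_coker_presheaf X F) y V t)" by (elim exE)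
  then show "\<exists>W V t. openin X W \<and> x \<in> W \<and> W \<subseteq> U \<and> openin X V \<and> (\<lambda>x. x) ` W \<subseteq> V \<and>
      t \<in> carrier (sections (godement_coker_presheaf X F) V) \<and>
      (\<forall>y\<in>W. z y = germ X (godement_coker_presheaf X F) y V t)"
    by (intro exI[of _ V] exI[of _ t]) auto
qed (rule U)

lemma godement_proj_closed:
  assumes "openin X U" "c \<in> carrier (sections (godement X F) U)"
  shows "godement_proj X F U c \<in> carrier (sections (godement_coker X F) U)"
proof (rule godement_coker_memI)
  fix x assume "x \<in> U"
  then show "\<exists>V t. openin X V \<and> x \<in> V \<and> V \<subseteq> U \<and>
       t \<in> carrier (sections (godement_coker_presheaf X F) V) \<and>
       (\<forall>y\<in>V. godement_proj X F U c y = germ X (godement_coker_presheaf X F) y V t)"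
    using assms unit.coker_carrierI[OF assms]
    by (intro exI[of _ U] exI[of _ "unit.img U +>\<^bsub>sections (godement X F) U\<^esub> c"])
      (auto simp: godement_proj_def godement_coker_presheaf_def)
qed (use assms in \<open>auto simp: godement_proj_def\<close>)

lemma godement_proj_unit:
  assumes "s \<in> carrier (sections F (topspace X))"
  shows "godement_proj X F (topspace X) (godement_unit X F (topspace X) s) =
    \<zero>\<^bsub>sections (godement_coker X F) (topspace X)\<^esub>"
proof -
  interpret abelian_subgroup "unit.img (topspace X)" "sections (godement X F) (topspace X)"
    by (rule unit.img_subgroup) simp
  have "unit.img (topspace X) +>\<^bsub>sections (godement X F) (topspace X)\<^esub>
      godement_unit X F (topspace X) s = unit.img (topspace X)"
    using assms by (intro a_rcos_const) auto
  then show ?thesis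
    by (simp add: godement_proj_def godement_coker_def sheafification_def stalk_zero
        godement_coker_presheaf_def unit.coker_zero cong: restrict_cong)
qed

lemma godement_diff_unit:
  assumes "s \<in> carrier (sections F (topspace X))"
  shows "godement_diff X F (topspace X) (godement_unit X F (topspace X) s) =
    \<zero>\<^bsub>sections (godement X (godement_coker X F)) (topspace X)\<^esub>"
  unfolding godement_diff_def godement_proj_unit[OF assms]
  by (simp add: godement_unit_def stalk_zero cong: restrict_cong)

lemma godement_proj_surj:
  assumes H1: "zero_module (sheaf_H1 X F)"
    and z: "z \<in> carrier (sections (godement_coker X F) (topspace X))"
  obtains c where "c \<in> carrier (sections (godement X F) (topspace X))"
    "godement_proj X F (topspace X) c = z"
proof -
  let ?T = "topspace X" and ?Z = "godement_coker X F"
  interpret Z: ab_presheaf X ?Z by (rule ab_presheaf_godement_coker)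
  interpret Z_unit: ab_presheaf_hom X ?Z "godement X ?Z" "godement_unit X ?Z"
    by (rule Z.godement_unit_hom)
  define C1 where "C1 = sections (godement X ?Z) ?T"
  define cocycles where "cocycles = {s \<in> carrier C1. godement_diff X ?Z ?T s =
      \<zero>\<^bsub>sections (godement X (godement_coker X ?Z)) ?T\<^esub>}"
  define N where "N = godement_diff X F ?T ` carrier (sections (godement X F) ?T)"
  let ?u = "godement_unit X ?Z ?T z"
  interpret C1: abelian_group C1
    unfolding C1_def by (rule Z_unit.G.sections_ab) simp
  have u: "?u \<in> carrier C1"
    unfolding C1_def using z by (intro Z_unit.hom_closed) auto
  then have "?u \<in> cocycles"
    using Z.godement_diff_unit[OF z] by (simp add: cocycles_def)
  moreover have "carrier (quotient_module (C1\<lparr>carrier := cocycles\<rparr>) N) = {N}"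
    using H1 unfolding zero_module_def sheaf_H1_def Let_def C1_def cocycles_def N_def
    by (simp add: quotient_module_def)
  ultimately have "N +>\<^bsub>C1\<lparr>carrier := cocycles\<rparr>\<^esub> ?u = N"
    by (auto simp: quotient_module_def A_RCOSETS_def')
  moreover have "\<zero>\<^bsub>C1\<^esub> \<in> N"
  proof -
    have 0: "\<zero>\<^bsub>sections F ?T\<^esub> \<in> carrier (sections F ?T)"
      by (intro abelian_groupE(2) sections_ab) simp
    then have "godement_unit X F ?T \<zero>\<^bsub>sections F ?T\<^esub> \<in> carrier (sections (godement X F) ?T)"
      by (intro unit.hom_closed) auto
    then show ?thesis
      unfolding N_def C1_def godement_diff_unit[OF 0, symmetric] by (rule imageI)
  qed
  moreover have "\<zero>\<^bsub>C1\<^esub> \<oplus>\<^bsub>C1\<^esub> ?u = ?u" using u by simp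
  ultimately have "?u \<in> N" by (fastforce simp: a_r_coset_def')
  then obtain c where c: "c \<in> carrier (sections (godement X F) ?T)" "?u = godement_diff X F ?T c"
    unfolding N_def by blast
  have pc: "godement_proj X F ?T c \<in> carrier (sections ?Z ?T)"
    using c by (intro godement_proj_closed) auto
  have "godement_proj X F ?T c x = z x" if x: "x \<in> ?T" for x
  proof -
    have "germ X ?Z x ?T z = germ X ?Z x ?T (godement_proj X F ?T c)"
      using fun_cong[OF c(2), of x] x by (simp add: godement_diff_def godement_unit_def)
    then obtain V where "x \<in> V" "res ?Z ?T V z = res ?Z ?T V (godement_proj X F ?T c)"
      by (rule Z.germ_eqE) (use x pc in auto)
    then show ?thesis
      by (simp add: godement_coker_def sheafification_def fun_eq_iff restrict_def) metis
  qed
  moreover have "z \<in> extensional ?T" "godement_proj X F ?T c \<in> extensional ?T"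
    using z pc
    by (auto simp: godement_coker_def sheafification_def inverse_image_carrier PiE_iff)
  ultimately have "godement_proj X F ?T c = z" by (intro extensionalityI) auto
  then show thesis using that c by blast
qed

end

section \<open>Mayer--Vietoris for two open sets\<close>

context sheaf
begin

interpretation unit: ab_presheaf_hom X F "godement X F" "godement_unit X F"
  by (rule godement_unit_hom)

interpretation coker_pre: ab_presheaf X "godement_coker_presheaf X F"
  unfolding godement_coker_presheaf_def by (rule unit.ab_presheaf_coker)

lemma germ_inject:
  assumes U: "openin X U" "s \<in> carrier (sections F U)" "t \<in> carrier (sections F U)"
    and eq: "\<And>x. x \<in> U \<Longrightarrow> germ X F x U s = germ X F x U t"
  shows "s = t"
proof -
  let ?\<U> = "{V. openin X V \<and> V \<subseteq> U \<and> res F U V s = res F U V t}"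
  have "\<exists>V\<in>?\<U>. x \<in> V" if x: "x \<in> U" for x
  proof -
    obtain V where "openin X V" "x \<in> V" "V \<subseteq> U" "res F U V s = res F U V t"
      by (rule germ_eqE[OF eq[OF x] U(1) x U(3)])
    then show ?thesis by blast
  qed
  then have "\<Union>?\<U> = U" by blast
  then show ?thesis using locality[of ?\<U> s t] U by simp
qed

lemma germ_glue:
  assumes U: "openin X U"
    and loc: "\<And>x. x \<in> U \<Longrightarrow> \<exists>V t. openin X V \<and> x \<in> V \<and> V \<subseteq> U \<and> t \<in> carrier (sections F V) \<and>
       (\<forall>y\<in>V. d y = germ X F y V t)"
  obtains t where "t \<in> carrier (sections F U)" "\<And>x. x \<in> U \<Longrightarrow> d x = germ X F x U t"
proof -
  define P where "P V t \<longleftrightarrow> t \<in> carrier (sections F V) \<and> (\<forall>y\<in>V. d y = germ X F y V t)" for V t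
  define \<U> where "\<U> = {V. openin X V \<and> V \<subseteq> U \<and> (\<exists>t. P V t)}"
  define \<sigma> where "\<sigma> V = (SOME t. P V t)" for V
  have \<sigma>: "P V (\<sigma> V)" if "V \<in> \<U>" for V
    using that someI_ex[of "P V"] by (auto simp: \<U>_def \<sigma>_def)
  have o: "openin X V" if "V \<in> \<U>" for V using that by (simp add: \<U>_def)
  have un: "\<Union>\<U> = U" using loc unfolding \<U>_def P_def by fastforce
  have "\<exists>s\<in>carrier (sections F (\<Union>\<U>)). \<forall>V\<in>\<U>. res F (\<Union>\<U>) V s = \<sigma> V"
  proof (rule gluing)
    fix V W assume VW: "V \<in> \<U>" "W \<in> \<U>"
    then have oi: "openin X (V \<inter> W)" using o by blast
    show "res F V (V \<inter> W) (\<sigma> V) = res F W (V \<inter> W) (\<sigma> W)"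
    proof (rule germ_inject[OF oi])
      fix x assume x: "x \<in> V \<inter> W"
      then have "d x = germ X F x V (\<sigma> V)" "d x = germ X F x W (\<sigma> W)"
        using \<sigma>[OF VW(1)] \<sigma>[OF VW(2)] by (auto simp: P_def)
      then show "germ X F x (V \<inter> W) (res F V (V \<inter> W) (\<sigma> V)) =
          germ X F x (V \<inter> W) (res F W (V \<inter> W) (\<sigma> W))"
        using x \<sigma>[OF VW(1)] \<sigma>[OF VW(2)] oi o[OF VW(1)] o[OF VW(2)]
        by (auto simp: germ_res P_def)
    qed (use \<sigma> VW oi o in \<open>auto simp: P_def intro!: res_closed\<close>)
  qed (use \<sigma> o in \<open>auto simp: P_def\<close>)
  then obtain s where s: "s \<in> carrier (sections F U)" "\<And>V. V \<in> \<U> \<Longrightarrow> res F U V s = \<sigma> V"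
    unfolding un by blast
  have "d x = germ X F x U s" if x: "x \<in> U" for x
  proof -
    obtain V where V: "V \<in> \<U>" "x \<in> V" using un x by blast
    have "d x = germ X F x V (res F U V s)" using \<sigma>[OF V(1)] V s by (simp add: P_def)
    also have "V \<subseteq> U" using V by (simp add: \<U>_def)
    then have "germ X F x V (res F U V s) = germ X F x U s"
      by (rule germ_res[OF U o[OF V(1)] V(2) _ s(1)])
    finally show ?thesis .
  qed
  with s show thesis using that by blast
qed

lemma godement_coker_lift:
  assumes U: "openin X U" and \<alpha>: "\<alpha> \<in> carrier (sections (godement X F) U)"
    and c: "c \<in> carrier (sections (godement X F) (topspace X))"
    and eq: "\<And>x. x \<in> U \<Longrightarrow> godement_proj X F (topspace X) c x = godement_proj X F U \<alpha> x"
  obtains a where "a \<in> carrier (sections F U)"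
    "\<And>x. x \<in> U \<Longrightarrow> \<alpha> x = germ X F x U a \<oplus>\<^bsub>stalk X F x\<^esub> c x"
proof -
  have UT: "U \<subseteq> topspace X" using U by (rule openin_subset)
  let ?d = "\<lambda>x. \<alpha> x \<ominus>\<^bsub>stalk X F x\<^esub> c x"
  have "\<exists>V t. openin X V \<and> x \<in> V \<and> V \<subseteq> U \<and> t \<in> carrier (sections F V) \<and>
       (\<forall>y\<in>V. ?d y = germ X F y V t)" if x: "x \<in> U" for x
  proof -
    have "germ X (godement_coker_presheaf X F) x (topspace X)
          (unit.img (topspace X) +>\<^bsub>sections (godement X F) (topspace X)\<^esub> c) =
        germ X (godement_coker_presheaf X F) x U (unit.img U +>\<^bsub>sections (godement X F) U\<^esub> \<alpha>)"
      using eq[OF x] x UT by (auto simp: godement_proj_def)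
    then obtain V where V: "openin X V" "x \<in> V" "V \<subseteq> topspace X" "V \<subseteq> U"
      and "res (godement_coker_presheaf X F) (topspace X) V
          (unit.img (topspace X) +>\<^bsub>sections (godement X F) (topspace X)\<^esub> c) =
        res (godement_coker_presheaf X F) U V (unit.img U +>\<^bsub>sections (godement X F) U\<^esub> \<alpha>)"
      by (rule coker_pre.germ_eqE)
        (use U x \<alpha> in \<open>auto simp: godement_coker_presheaf_def intro!: unit.coker_carrierI\<close>)
    then have "unit.img V +>\<^bsub>sections (godement X F) V\<^esub> restrict \<alpha> V =
        unit.img V +>\<^bsub>sections (godement X F) V\<^esub> restrict c V"
      using U c \<alpha> by (simp add: godement_coker_presheaf_def unit.coker_res)
    moreover have "restrict \<alpha> V \<in> carrier (sections (godement X F) V)"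
      "restrict c V \<in> carrier (sections (godement X F) V)"
      using V c \<alpha> by (auto simp: PiE_iff)
    ultimately obtain r where r: "r \<in> carrier (sections F V)"
      and "restrict \<alpha> V = godement_unit X F V r \<oplus>\<^bsub>sections (godement X F) V\<^esub> restrict c V"
      using V(1) by (auto simp only: unit.coset_eq_iff)
    then have eqr: "\<alpha> y = germ X F y V r \<oplus>\<^bsub>stalk X F y\<^esub> c y" if "y \<in> V" for y
      using that by (auto simp: fun_eq_iff godement_unit_def split: if_splits)
    have "?d y = germ X F y V r" if y: "y \<in> V" for y
    proof -
      interpret S: abelian_group "stalk X F y" using y V stalk_ab by blast
      have "c y \<in> carrier (stalk X F y)" using c V y by (auto simp: PiE_iff)
      then show ?thesis
        using eqr[OF y] germ_in_stalk[OF V(1) y r]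
        by (simp add: S.minus_eq S.a_assoc S.r_neg)
    qed
    then show ?thesis using V r by blast
  qed
  then obtain a where a: "a \<in> carrier (sections F U)" "\<And>x. x \<in> U \<Longrightarrow> ?d x = germ X F x U a"
    using germ_glue[OF U, of ?d] by blast
  have "\<alpha> x = germ X F x U a \<oplus>\<^bsub>stalk X F x\<^esub> c x" if x: "x \<in> U" for x
  proof -
    interpret S: abelian_group "stalk X F x" using x UT stalk_ab by blast
    have "c x \<in> carrier (stalk X F x)" "\<alpha> x \<in> carrier (stalk X F x)"
      using c \<alpha> UT x by (auto simp: PiE_iff)
    then show ?thesis
      by (simp flip: a(2)[OF x] add: S.minus_eq S.a_assoc S.l_neg)
  qed
  with a show thesis using that by blast
qed

text \<open>The section \<open>s\<close>, extended by zero to \<open>U1\<close>, and the zero section over \<open>U2\<close> differ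
  by \<open>s\<close> on the overlap, so they define a global section of the cokernel sheaf; a lift \<open>c\<close> of
  it to a discontinuous section differs on \<open>U1\<close> and \<open>U2\<close> from these two by sections of \<open>F\<close>.\<close>

lemma mayer_vietoris:
  assumes H1: "zero_module (sheaf_H1 X F)"
    and U: "openin X U1" "openin X U2" "U1 \<union> U2 = topspace X"
    and s: "s \<in> carrier (sections F (U1 \<inter> U2))"
  obtains a b where "a \<in> carrier (sections F U1)" "b \<in> carrier (sections F U2)"
    "s \<oplus>\<^bsub>sections F (U1 \<inter> U2)\<^esub> res F U2 (U1 \<inter> U2) b = res F U1 (U1 \<inter> U2) a"
proof -
  let ?I = "U1 \<inter> U2" and ?P = "godement_coker_presheaf X F" and ?T = "topspace X"
  define \<alpha> where "\<alpha> = (\<lambda>x\<in>U1. if x \<in> U2 then germ X F x ?I s else \<zero>\<^bsub>stalk X F x\<^esub>)"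
  define \<beta> where "\<beta> = (\<lambda>x\<in>U2. \<zero>\<^bsub>stalk X F x\<^esub>)"
  define A where "A = unit.img U1 +>\<^bsub>sections (godement X F) U1\<^esub> \<alpha>"
  define B where "B = unit.img U2 +>\<^bsub>sections (godement X F) U2\<^esub> \<beta>"
  have I: "openin X ?I" using U by blast
  have ab: "abelian_group (stalk X F x)" if "x \<in> U1 \<or> x \<in> U2" for x
    using that U(3) by (intro stalk_ab) blast
  have \<alpha>: "\<alpha> \<in> carrier (sections (godement X F) U1)"
    using s I by (auto simp: \<alpha>_def germ_in_stalk intro!: abelian_groupE(2) ab)
  have \<beta>: "\<beta> \<in> carrier (sections (godement X F) U2)"
    by (auto simp: \<beta>_def intro!: abelian_groupE(2) ab)
  have A: "A \<in> carrier (sections ?P U1)" and B: "B \<in> carrier (sections ?P U2)"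
    unfolding A_def B_def godement_coker_presheaf_def
    using U \<alpha> \<beta> by (auto intro!: unit.coker_carrierI)
  have "restrict \<alpha> ?I = godement_unit X F ?I s \<oplus>\<^bsub>sections (godement X F) ?I\<^esub> restrict \<beta> ?I"
    using s I
    by (auto simp: \<alpha>_def \<beta>_def godement_unit_def germ_in_stalk fun_eq_iff
        abelian_monoid.r_zero[OF abelian_group.axioms(1)[OF ab]])
  moreover have "restrict \<alpha> ?I \<in> carrier (sections (godement X F) ?I)"
    "restrict \<beta> ?I \<in> carrier (sections (godement X F) ?I)"
    using \<alpha> \<beta> by (auto simp: PiE_iff)
  ultimately have "unit.img ?I +>\<^bsub>sections (godement X F) ?I\<^esub> restrict \<alpha> ?I =
      unit.img ?I +>\<^bsub>sections (godement X F) ?I\<^esub> restrict \<beta> ?I"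
    using I s by (subst unit.coset_eq_iff) auto
  then have res_AB: "res ?P U1 ?I A = res ?P U2 ?I B"
    using U I \<alpha> \<beta> by (simp add: A_def B_def godement_coker_presheaf_def unit.coker_res)
  define z where "z = (\<lambda>x\<in>?T. if x \<in> U1 then germ X ?P x U1 A else germ X ?P x U2 B)"
  have z1: "z x = germ X ?P x U1 A" if "x \<in> U1" for x using that U by (auto simp: z_def)
  have z2: "z x = germ X ?P x U2 B" if x: "x \<in> U2" for x
  proof (cases "x \<in> U1")
    case True
    then have "germ X ?P x U1 A = germ X ?P x U2 B"
      using U I A B res_AB x by (intro coker_pre.germ_eqI[where W = ?I]) auto
    then show ?thesis using True z1 by simp
  qed (use that U in \<open>auto simp: z_def\<close>)
  have "z \<in> carrier (sections (godement_coker X F) ?T)"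
  proof (rule godement_coker_memI)
    show "\<exists>V t. openin X V \<and> x \<in> V \<and> V \<subseteq> ?T \<and> t \<in> carrier (sections ?P V) \<and>
       (\<forall>y\<in>V. z y = germ X ?P y V t)" if "x \<in> ?T" for x
      using that U A B z1 z2 openin_subset by (metis UnE)
  qed (auto simp: z_def)
  then obtain c where c: "c \<in> carrier (sections (godement X F) ?T)" "godement_proj X F ?T c = z"
    by (rule godement_proj_surj[OF H1])
  have proj: "x \<in> U1 \<Longrightarrow> godement_proj X F ?T c x = godement_proj X F U1 \<alpha> x"
    "x \<in> U2 \<Longrightarrow> godement_proj X F ?T c x = godement_proj X F U2 \<beta> x" for x
    unfolding c(2) by (simp add: z1 godement_proj_def A_def, simp add: z2 godement_proj_def B_def)
  obtain a where a: "a \<in> carrier (sections F U1)"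
    "\<And>x. x \<in> U1 \<Longrightarrow> \<alpha> x = germ X F x U1 a \<oplus>\<^bsub>stalk X F x\<^esub> c x"
    using godement_coker_lift[OF U(1) \<alpha> c(1) proj(1)] by blast
  obtain b where b: "b \<in> carrier (sections F U2)"
    "\<And>x. x \<in> U2 \<Longrightarrow> \<beta> x = germ X F x U2 b \<oplus>\<^bsub>stalk X F x\<^esub> c x"
    using godement_coker_lift[OF U(2) \<beta> c(1) proj(2)] by blast
  have rab: "res F U1 ?I a \<in> carrier (sections F ?I)" "res F U2 ?I b \<in> carrier (sections F ?I)"
    using U I a b by (auto intro: res_closed)
  have "s \<oplus>\<^bsub>sections F ?I\<^esub> res F U2 ?I b = res F U1 ?I a"
  proof (rule germ_inject[OF I])
    fix x assume x: "x \<in> ?I"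
    interpret S: abelian_group "stalk X F x" using x ab by blast
    have cl: "c x \<in> carrier (stalk X F x)" "germ X F x U1 a \<in> carrier (stalk X F x)"
        "germ X F x U2 b \<in> carrier (stalk X F x)"
      using c x U a b by (auto simp: PiE_iff germ_in_stalk)
    have "germ X F x ?I s = germ X F x U1 a \<oplus>\<^bsub>stalk X F x\<^esub> c x"
      using a(2)[of x] x by (simp add: \<alpha>_def)
    moreover have "\<zero>\<^bsub>stalk X F x\<^esub> = germ X F x U2 b \<oplus>\<^bsub>stalk X F x\<^esub> c x"
      using b(2)[of x] x by (simp add: \<beta>_def)
    ultimately have "germ X F x ?I s \<oplus>\<^bsub>stalk X F x\<^esub> germ X F x U2 b = germ X F x U1 a"
      using cl by (simp add: S.a_assoc S.a_comm[of "c x"])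
    then show "germ X F x ?I (s \<oplus>\<^bsub>sections F ?I\<^esub> res F U2 ?I b) = germ X F x ?I (res F U1 ?I a)"
      using x I s rab U a b by (simp flip: germ_add add: germ_res)
  qed (use s rab abelian_groupE(1)[OF sections_ab[OF I]] in auto)
  with a b show thesis using that by blast
qed

end

section \<open>Open embeddings\<close>

lemma open_embedding_open_image:
  assumes "open_embedding X Y f" "openin X U"
  shows "openin Y (f ` U)"
proof -
  have "openin (subtopology Y (f ` topspace X)) (f ` U)"
    using assms homeomorphic_map_openness_eq
    by (auto simp: open_embedding_def embedding_map_def)
  then show ?thesis using assms openin_open_subtopology by (auto simp: open_embedding_def)
qed

lemma open_embedding_continuous: "open_embedding X Y f \<Longrightarrow> continuous_map X Y f"
  by (auto simp: open_embedding_def embedding_map_def continuous_map_in_subtopology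
      dest: homeomorphic_imp_continuous_map)

lemma open_embedding_inj: "open_embedding X Y f \<Longrightarrow> inj_on f (topspace X)"
  by (auto simp: open_embedding_def embedding_map_def homeomorphic_imp_injective_map)

lemma (in ab_presheaf) inverse_image_germI:
  assumes "openin Z U" "openin X V" "f ` U \<subseteq> V" "t \<in> carrier (sections F V)"
  shows "(\<lambda>x\<in>U. germ X F (f x) V t) \<in> carrier (sections (inverse_image Z f X F) U)"
proof (rule inverse_image_memI)
  show "f ` U \<subseteq> topspace X" using assms openin_subset by fast
  show "\<exists>W N r. openin Z W \<and> x \<in> W \<and> W \<subseteq> U \<and> openin X N \<and> f ` W \<subseteq> N \<and>
      r \<in> carrier (sections F N) \<and> (\<forall>y\<in>W. (\<lambda>x\<in>U. germ X F (f x) V t) y = germ X F (f y) N r)"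
    if "x \<in> U" for x
    using that assms by (intro exI[of _ U] exI[of _ V] exI[of _ t]) auto
qed auto

lemma (in sheaf) inverse_image_open_embedding:
  assumes f: "open_embedding Z X f" and U: "openin Z U"
    and s: "s \<in> carrier (sections (inverse_image Z f X F) U)"
  obtains t where "t \<in> carrier (sections F (f ` U))"
    "\<And>x. x \<in> U \<Longrightarrow> s x = germ X F (f x) (f ` U) t"
proof -
  have inj: "inj_on f U" by (rule inj_on_subset[OF open_embedding_inj[OF f] openin_subset[OF U]])
  have "\<exists>V t. openin X V \<and> y \<in> V \<and> V \<subseteq> f ` U \<and> t \<in> carrier (sections F V) \<and>
       (\<forall>y\<in>V. s (inv_into U f y) = germ X F y V t)" if y: "y \<in> f ` U" for y
  proof -
    from y obtain x where x: "x \<in> U" "y = f x" by blast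
    with s obtain W N t where W: "openin Z W" "x \<in> W" "W \<subseteq> U" "openin X N" "f ` W \<subseteq> N"
        "t \<in> carrier (sections F N)" and t: "\<forall>y\<in>W. s y = germ X F (f y) N t"
      unfolding inverse_image_carrier by blast
    have o: "openin X (f ` W)" using f W open_embedding_open_image by blast
    have "s (inv_into U f (f w)) = germ X F (f w) (f ` W) (res F N (f ` W) t)" if "w \<in> W" for w
    proof -
      have "inv_into U f (f w) = w" using that W inj by (auto intro: inv_into_f_f)
      moreover have "germ X F (f w) (f ` W) (res F N (f ` W) t) = germ X F (f w) N t"
        using that W o by (intro germ_res) auto
      ultimately show ?thesis using t that by simp
    qed
    then show ?thesis
      using W o x res_closed[OF W(4) o W(5,6)]
      by (intro exI[of _ "f ` W"] exI[of _ "res F N (f ` W) t"]) auto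
  qed
  then obtain t where t: "t \<in> carrier (sections F (f ` U))"
      "\<And>y. y \<in> f ` U \<Longrightarrow> s (inv_into U f y) = germ X F y (f ` U) t"
    using germ_glue[OF open_embedding_open_image[OF f U], of "\<lambda>y. s (inv_into U f y)"] by blast
  have "s x = germ X F (f x) (f ` U) t" if "x \<in> U" for x
    using t(2)[of "f x"] that inj by (simp add: inv_into_f_f)
  with t show thesis using that by blast
qed

theorem lemma3p4:
  fixes X :: "'a topology" and F :: "('a, 's) presheaf_data"
    and X' :: "'b topology" and F' :: "('b, 't) presheaf_data"
    and i :: "'a \<Rightarrow> 'b" and W K :: "'a set"
  assumes "clch_space X" and "sheaf X F"
    and "domain_in X W" and "hartogs_pair K (subtopology X W)"
    and "clch_space X'" and "sheaf X' F'" and "zero_module (sheaf_H1 X' F')"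
    and "open_embedding X X' i" and "sheaf_isomorphic X F (inverse_image X i X' F')"
    and "hartogs_sheaf X F K"
  shows "hartogs_sheaf (subtopology X W) (restrict_sheaf F W) K"
proof -
  interpret F: sheaf X F by fact
  interpret F': sheaf X' F' by fact
  let ?T = "topspace X" and ?I = "inverse_image X i X' F'"
  let ?U1 = "topspace X' - i ` K" and ?U2 = "i ` W" and ?O = "i ` (W - K)"
  from \<open>sheaf_isomorphic X F ?I\<close> obtain \<phi>
    where \<phi>: "\<And>U. openin X U \<Longrightarrow> \<phi> U \<in> linear_maps (sections F U) (sections ?I U)"
      and bij: "\<And>U. openin X U \<Longrightarrow>
        bij_betw (\<phi> U) (carrier (sections F U)) (carrier (sections ?I U))"
      and nat: "\<And>U V s. \<lbrakk>openin X U; openin X V; V \<subseteq> U; s \<in> carrier (sections F U)\<rbrakk>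
        \<Longrightarrow> \<phi> V (res F U V s) = restrict (\<phi> U s) V"
    unfolding sheaf_isomorphic_def by (metis inverse_image_sel(3))
  have W: "openin X W" "W \<subseteq> ?T" using \<open>domain_in X W\<close> openin_subset by (auto simp: domain_in_def)
  have K: "compactin X K" "K \<subseteq> W"
    using \<open>hartogs_pair K (subtopology X W)\<close> by (auto simp: hartogs_pair_def compactin_subtopology)
  have closed: "closedin Y C" if "clch_space Y" "compactin Y C" for Y :: "'c topology" and C
    using that compactin_imp_closedin by (auto simp: clch_space_def)
  have oTK: "openin X (?T - K)" and oWK: "openin X (W - K)"
    using closed[OF \<open>clch_space X\<close> K(1)] W by (auto intro: openin_diff)
  have U1: "openin X' ?U1"
    using closed[OF \<open>clch_space X'\<close>] image_compactin[OF K(1)] open_embedding_continuous assms(8)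
    by (blast intro: openin_diff)
  have U2: "openin X' ?U2" using assms(8) W open_embedding_open_image by blast
  have inj: "inj_on i ?T" using assms(8) by (rule open_embedding_inj)
  have Int: "?U1 \<inter> ?U2 = ?O"
    using inj_on_image_set_diff[OF inj, of W K] K W openin_subset[OF U2] by blast
  have Un: "?U1 \<union> ?U2 = topspace X'" using K openin_subset[OF U2] by blast
  have "openin X' (i ` ?T)" using assms(8) open_embedding_open_image openin_topspace by blast
  then have iU1: "i ` (?T - K) \<subseteq> ?U1"
    using inj_on_image_set_diff[OF inj, of ?T K] K W openin_subset by blast
  have ext: "\<exists>u\<in>carrier (sections F W). res F W (W - K) u = s"
    if s: "s \<in> carrier (sections F (W - K))" for s
  proof -
    have "\<phi> (W - K) s \<in> carrier (sections ?I (W - K))"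
      using \<phi>[OF oWK] s by (rule linear_maps_closed)
    then obtain s' where s': "s' \<in> carrier (sections F' ?O)"
      "\<And>x. x \<in> W - K \<Longrightarrow> \<phi> (W - K) s x = germ X' F' (i x) ?O s'"
      using F'.inverse_image_open_embedding[OF assms(8) oWK] by blast
    obtain a b where ab: "a \<in> carrier (sections F' ?U1)" "b \<in> carrier (sections F' ?U2)"
      "s' \<oplus>\<^bsub>sections F' ?O\<^esub> res F' ?U2 ?O b = res F' ?U1 ?O a"
      using F'.mayer_vietoris[OF assms(7) U1 U2 Un, unfolded Int, OF s'(1)] by blast
    have "(\<lambda>x\<in>?T - K. germ X' F' (i x) ?U1 a) \<in> carrier (sections ?I (?T - K))"
      "(\<lambda>x\<in>W. germ X' F' (i x) ?U2 b) \<in> carrier (sections ?I W)"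
      using oTK W U1 U2 iU1 ab by (auto intro!: F'.inverse_image_germI simp del: restrict_apply)
    then obtain A B where A: "A \<in> carrier (sections F (?T - K))"
        "\<phi> (?T - K) A = (\<lambda>x\<in>?T - K. germ X' F' (i x) ?U1 a)"
      and B: "B \<in> carrier (sections F W)" "\<phi> W B = (\<lambda>x\<in>W. germ X' F' (i x) ?U2 b)"
      using bij_betw_imp_surj_on[OF bij[OF oTK]] bij_betw_imp_surj_on[OF bij[OF W(1)]]
      by (metis (no_types, lifting) imageE)
    from A(1) obtain C where C: "C \<in> carrier (sections F ?T)" "res F ?T (?T - K) C = A"
      using \<open>hartogs_sheaf X F K\<close> unfolding hartogs_sheaf_def by (metis imageE)
    have sub: "W - K \<subseteq> ?T - K" using W by blast
    let ?B = "res F W (W - K) B" and ?A = "res F (?T - K) (W - K) A"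
    have cl: "?B \<in> carrier (sections F (W - K))" "?A \<in> carrier (sections F (W - K))"
      using A B oWK oTK W sub by (auto intro: F.res_closed)
    interpret G: abelian_group "sections F (W - K)" by (rule F.sections_ab[OF oWK])
    have eq: "s \<oplus>\<^bsub>sections F (W - K)\<^esub> ?B = ?A"
    proof (rule inj_onD[OF bij_betw_imp_inj_on[OF bij[OF oWK]]])
      have "\<phi> (W - K) (s \<oplus>\<^bsub>sections F (W - K)\<^esub> ?B) =
          (\<lambda>x\<in>W - K. \<phi> (W - K) s x \<oplus>\<^bsub>stalk X' F' (i x)\<^esub> \<phi> (W - K) ?B x)"
        using linear_maps_add[OF \<phi>[OF oWK] s cl(1)] by simp
      also have "\<dots> = (\<lambda>x\<in>W - K. germ X' F' (i x) ?U1 a)"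
      proof (rule restrict_ext)
        fix x assume x: "x \<in> W - K"
        have oO: "openin X' ?O" using assms(8) oWK open_embedding_open_image by blast
        have sO: "?O \<subseteq> ?U1" "?O \<subseteq> ?U2" "i x \<in> ?O" using x Int by auto
        have "\<phi> (W - K) ?B x = germ X' F' (i x) ?U2 b"
          using nat[OF W(1) oWK _ B(1)] B(2) x by simp
        also have "\<dots> = germ X' F' (i x) ?O (res F' ?U2 ?O b)"
          using F'.germ_res[OF U2 oO sO(3,2) ab(2)] by simp
        finally have "\<phi> (W - K) s x \<oplus>\<^bsub>stalk X' F' (i x)\<^esub> \<phi> (W - K) ?B x =
            germ X' F' (i x) ?O (res F' ?U1 ?O a)"
          using s' x oO sO U2 ab F'.res_closed[OF U2 oO sO(2) ab(2)]
          by (simp add: F'.germ_add)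
        then show "\<phi> (W - K) s x \<oplus>\<^bsub>stalk X' F' (i x)\<^esub> \<phi> (W - K) ?B x = germ X' F' (i x) ?U1 a"
          using F'.germ_res[OF U1 oO sO(3,1) ab(1)] by simp
      qed
      also have "\<dots> = \<phi> (W - K) ?A"
        using nat[OF oTK oWK sub A(1)] A(2) sub by (auto simp: fun_eq_iff)
      finally show "\<phi> (W - K) (s \<oplus>\<^bsub>sections F (W - K)\<^esub> ?B) = \<phi> (W - K) ?A" .
    qed (use s cl in auto)
    interpret GW: abelian_group "sections F W" by (rule F.sections_ab[OF W(1)])
    let ?C = "res F ?T W C"
    have C': "?C \<in> carrier (sections F W)" using C W by (auto intro: F.res_closed)
    have negB: "\<ominus>\<^bsub>sections F W\<^esub> B \<in> carrier (sections F W)" using B by simp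
    have rneg: "res F W (W - K) (\<ominus>\<^bsub>sections F W\<^esub> B) \<in> carrier (sections F (W - K))"
      using negB W oWK by (auto intro: F.res_closed)
    have neg: "?B \<oplus>\<^bsub>sections F (W - K)\<^esub> res F W (W - K) (\<ominus>\<^bsub>sections F W\<^esub> B) =
        \<zero>\<^bsub>sections F (W - K)\<^esub>"
      using F.res_add[OF W(1) oWK _ B(1) negB] F.res_zero[OF W(1) oWK] B by (auto simp: GW.r_neg)
    have "res F W (W - K) (?C \<oplus>\<^bsub>sections F W\<^esub> \<ominus>\<^bsub>sections F W\<^esub> B) =
        res F ?T (W - K) C \<oplus>\<^bsub>sections F (W - K)\<^esub> res F W (W - K) (\<ominus>\<^bsub>sections F W\<^esub> B)"
      using F.res_add[OF W(1) oWK _ C' negB] F.res_res[OF _ W(1) oWK _ W(2) C(1)] by auto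
    also have "res F ?T (W - K) C = s \<oplus>\<^bsub>sections F (W - K)\<^esub> ?B"
      using F.res_res[OF _ oTK oWK sub _ C(1)] C(2) eq by auto
    also have "\<dots> \<oplus>\<^bsub>sections F (W - K)\<^esub> res F W (W - K) (\<ominus>\<^bsub>sections F W\<^esub> B) = s"
      using s cl rneg neg by (simp add: G.a_assoc)
    finally show ?thesis using C' negB by blast
  qed
  have W_eq: "W \<inter> topspace (subtopology X W) = W" "W \<inter> (topspace (subtopology X W) - K) = W - K"
    using W by auto
  have "res F W (W - K) u \<in> carrier (sections F (W - K))"
    if "u \<in> carrier (sections F W)" for u
    using that W oWK by (auto intro: F.res_closed)
  then have "res F W (W - K) ` carrier (sections F W) = carrier (sections F (W - K))"
    by (intro subset_antisym subsetI) (use ext in blast)+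
  with W_eq show ?thesis
    by (simp add: hartogs_sheaf_def restrict_sheaf_def del: topspace_subtopology)
qed

end
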